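(* Let $(X,d)$ be a non-empty compact pseudo-metric space, let $\varPhi$ be a set of real-valued continuous functions on $X$, and let $G$ be a subgroup of $\mathrm{Homeo}(X)$ such that $\varphi\circ g\in\varPhi$ for every $\varphi\in\varPhi$ and $g\in G$. Let $(a_k)_{k\ge1}$ be a decreasing sequence of positive real numbers with $\sum_{k=1}^\infty a_k\le 1$. Let $(F_k)_{k\ge 1}$ be a sequence of GENEOs for $(\varPhi,G)$ such that for every $\varphi\in\varPhi$ there exists $M(\varphi)>0$ with $$\left|\sum_{k=1}^n F_k(\varphi)(x)\right|\le M(\varphi)\qquad\text{for every } x\in X \text{ and every } n\in\mathbb{N}.$$ Define the operator $F:\varPhi\to C^0_b(X,\mathbb{R})$ by $$F(\varphi):=\sum_{k=1}^\infty a_kF_k(\varphi),$$ the series being uniformly convergent on $X$ for every $\varphi\in\varPhi$ under these assumptions. If $F(\varPhi)\subseteq\varPhi$, then $F$ is a GENEO for $(\varPhi,G)$.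
   Context: $C^0_b(X,\mathbb{R})$ is the space of bounded continuous functions $X\to\mathbb{R}$, endowed with the sup-norm $\|\cdot\|_\infty$. $\mathrm{Homeo}(X)$ is the group of all homeomorphisms from $X$ to itself, where $X$ carries the topology induced by the pseudo-metric $d$. The set $\varPhi$ is a subset of $C^0_b(X,\mathbb{R})$ with the induced topology (not assumed to be a linear subspace). A $G$-equivariant non-expansive operator (GENEO) for $(\varPhi,G)$ is a function $F:\varPhi\to\varPhi$ (not required to be linear) such that: (1) $F(\varphi\circ g)=F(\varphi)\circ g$ for all $\varphi\in\varPhi$ and $g\in G$; (2) $\|F(\varphi_1)-F(\varphi_2)\|_\infty\le\|\varphi_1-\varphi_2\|_\infty$ for all $\varphi_1,\varphi_2\in\varPhi$. *)

theory Defs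
  imports "HOL-Analysis.Analysis" "HOL-Algebra.Bij"
begin

text \<open>Unlike in the library locale \<open>Metric_space\<close>, distinct points may have distance 0.\<close>

locale pseudometric_space =
  fixes X :: "'a set" and d :: "'a \<Rightarrow> 'a \<Rightarrow> real"
  assumes nonneg: "\<lbrakk>x \<in> X; y \<in> X\<rbrakk> \<Longrightarrow> 0 \<le> d x y"
    and refl: "x \<in> X \<Longrightarrow> d x x = 0"
    and commute: "\<lbrakk>x \<in> X; y \<in> X\<rbrakk> \<Longrightarrow> d x y = d y x"
    and triangle: "\<lbrakk>x \<in> X; y \<in> X; z \<in> X\<rbrakk> \<Longrightarrow> d x z \<le> d x y + d y z"

definition pseudometric_topology :: "'a set \<Rightarrow> ('a \<Rightarrow> 'a \<Rightarrow> real) \<Rightarrow> 'a topology" where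
  "pseudometric_topology X d =
     topology (\<lambda>U. U \<subseteq> X \<and> (\<forall>x\<in>U. \<exists>r>0. {y \<in> X. d x y < r} \<subseteq> U))"

lemma openin_pseudometric_topology:
  "openin (pseudometric_topology X d) U \<longleftrightarrow>
     U \<subseteq> X \<and> (\<forall>x\<in>U. \<exists>r>0. {y \<in> X. d x y < r} \<subseteq> U)"
proof -
  have "istopology (\<lambda>U. U \<subseteq> X \<and> (\<forall>x\<in>U. \<exists>r>0. {y \<in> X. d x y < r} \<subseteq> U))"
    unfolding istopology_def
  proof (rule conjI; intro allI impI conjI ballI)
    fix S T x
    assume S: "S \<subseteq> X \<and> (\<forall>x\<in>S. \<exists>r>0. {y \<in> X. d x y < r} \<subseteq> S)"
      and T: "T \<subseteq> X \<and> (\<forall>x\<in>T. \<exists>r>0. {y \<in> X. d x y < r} \<subseteq> T)"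
    show "S \<inter> T \<subseteq> X" using S by blast
    assume "x \<in> S \<inter> T"
    then obtain r s where "r > 0" "{y \<in> X. d x y < r} \<subseteq> S" "s > 0" "{y \<in> X. d x y < s} \<subseteq> T"
      using S T by blast
    then show "\<exists>r>0. {y \<in> X. d x y < r} \<subseteq> S \<inter> T"
      by (intro exI[of _ "min r s"]) (simp add: subset_iff)
  next
    fix K
    assume K: "\<forall>S\<in>K. S \<subseteq> X \<and> (\<forall>x\<in>S. \<exists>r>0. {y \<in> X. d x y < r} \<subseteq> S)"
    show "\<Union>K \<subseteq> X" using K by blast
    fix x assume "x \<in> \<Union>K"
    then obtain S where S: "S \<in> K" "x \<in> S" by blast
    with K obtain r where "r > 0" "{y \<in> X. d x y < r} \<subseteq> S" by blast
    with S(1) show "\<exists>r>0. {y \<in> X. d x y < r} \<subseteq> \<Union>K" by blast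
  qed
  then show ?thesis by (simp add: pseudometric_topology_def)
qed

lemma topspace_pseudometric_topology [simp]: "topspace (pseudometric_topology X d) = X"
proof
  show "topspace (pseudometric_topology X d) \<subseteq> X"
    using openin_topspace[of "pseudometric_topology X d"]
    unfolding openin_pseudometric_topology[of X d "topspace (pseudometric_topology X d)"]
    by (rule conjunct1)
  have "openin (pseudometric_topology X d) X"
    by (subst openin_pseudometric_topology) (blast intro: zero_less_one)
  then show "X \<subseteq> topspace (pseudometric_topology X d)" by (rule openin_subset)
qed

definition Homeo :: "'a topology \<Rightarrow> ('a \<Rightarrow> 'a) monoid" where
  "Homeo T = (BijGroup (topspace T))
     \<lparr>carrier := {g \<in> Bij (topspace T). homeomorphic_map T T g}\<rparr>"

lemma group_Homeo: "group (Homeo T)"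
proof -
  let ?X = "topspace T"
  let ?H = "{g \<in> Bij ?X. homeomorphic_map T T g}"
  interpret B: group "BijGroup ?X" by (rule group_BijGroup)
  have inv: "restrict (inv_into ?X g) ?X \<in> ?H" and inveq: "inv\<^bsub>BijGroup ?X\<^esub> g = restrict (inv_into ?X g) ?X"
    if "g \<in> ?H" for g
  proof -
    from that have g: "g \<in> Bij ?X" "homeomorphic_map T T g" by auto
    then obtain h where h: "homeomorphic_maps T T g h" using homeomorphic_map_maps by blast
    have eq: "inv_into ?X g x = h x" if x: "x \<in> ?X" for x
    proof (rule inv_into_f_eq)
      show "inj_on g ?X" using g(1) by (simp add: Bij_def bij_betw_def)
      show "h x \<in> ?X" "g (h x) = x"
        using h x by (auto simp: homeomorphic_maps_def continuous_map_def)
    qed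
    have "homeomorphic_map T T h" using h homeomorphic_maps_map homeomorphic_maps_sym by blast
    then have "homeomorphic_map T T (restrict (inv_into ?X g) ?X)"
      by (rule homeomorphic_map_eq) (simp add: eq)
    then show *: "restrict (inv_into ?X g) ?X \<in> ?H"
      using restrict_inv_into_Bij[OF g(1)] by simp
    show "inv\<^bsub>BijGroup ?X\<^esub> g = restrict (inv_into ?X g) ?X"
      using g(1) * by (intro B.inv_equality)
        (auto simp: BijGroup_def Bij_compose_restrict_eq)
  qed
  have "subgroup ?H (BijGroup ?X)"
  proof
    show "?H \<subseteq> carrier (BijGroup ?X)" by (auto simp: BijGroup_def)
    show "\<one>\<^bsub>BijGroup ?X\<^esub> \<in> ?H"
    proof -
      have "homeomorphic_map T T id" by simp
      then have "homeomorphic_map T T (\<lambda>x\<in>?X. x)" by (rule homeomorphic_map_eq) simp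
      then show ?thesis by (simp add: BijGroup_def id_Bij)
    qed
    show "inv\<^bsub>BijGroup ?X\<^esub> g \<in> ?H" if "g \<in> ?H" for g
      using inv[OF that] inveq[OF that] by simp
    show "f \<otimes>\<^bsub>BijGroup ?X\<^esub> g \<in> ?H" if "f \<in> ?H" "g \<in> ?H" for f g
    proof -
      have "homeomorphic_map T T (f \<circ> g)"
        using that homeomorphic_map_compose by blast
      then have "homeomorphic_map T T (compose ?X f g)"
        by (rule homeomorphic_map_eq) (simp add: compose_def)
      then show ?thesis using that by (simp add: BijGroup_def compose_Bij)
    qed
  qed
  then show ?thesis unfolding Homeo_def by (rule B.subgroup_imp_group)
qed

text \<open>Functions on \<open>X\<close> are represented by their extensional representatives, so that
  \<open>compose X \<phi> g\<close> is \<open>\<phi> \<circ> g\<close> and equality of functions is HOL equality.\<close>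

abbreviation C0b :: "'a topology \<Rightarrow> ('a \<Rightarrow> real) set" where
  "C0b T \<equiv> mspace (cfunspace T euclidean_metric)"

lemma C0b_iff:
  "\<phi> \<in> C0b T \<longleftrightarrow>
     \<phi> \<in> extensional (topspace T) \<and> bounded (\<phi> ` topspace T) \<and> continuous_map T euclideanreal \<phi>"
proof -
  have "Met_TC.mbounded S \<longleftrightarrow> bounded S" for S :: "real set"
    unfolding Met_TC.mbounded_def mcball_eq_cball
    by (metis bounded_subset bounded_cball bounded_subset_cball)
  then show ?thesis
    unfolding mspace_cfunspace by simp
qed

definition sup_norm :: "'a set \<Rightarrow> ('a \<Rightarrow> real) \<Rightarrow> real" where
  "sup_norm X f = (SUP x\<in>X. \<bar>f x\<bar>)"

lemma mdist_cfunspace_eq_sup_norm: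
  assumes "\<phi> \<in> C0b T" "\<psi> \<in> C0b T" "topspace T \<noteq> {}"
  shows "mdist (cfunspace T euclidean_metric) \<phi> \<psi> = sup_norm (topspace T) (\<lambda>x. \<phi> x - \<psi> x)"
proof -
  have "\<phi> \<in> Met_TC.fspace (topspace T)" "\<psi> \<in> Met_TC.fspace (topspace T)"
    using assms(1,2)[THEN subsetD[OF cfunspace_subset_funspace]]
    unfolding mspace_funspace mspace_euclidean_metric mdist_euclidean_metric .
  then show ?thesis
    unfolding mdist_cfunspace_eq_mdist_funspace mdist_funspace mspace_euclidean_metric
      mdist_euclidean_metric Met_TC.fdist_def sup_norm_def dist_real_def
    using assms(3) by simp
qed

definition GENEO ::
  "'a set \<Rightarrow> ('a \<Rightarrow> real) set \<Rightarrow> ('a \<Rightarrow> 'a) set \<Rightarrow> (('a \<Rightarrow> real) \<Rightarrow> 'a \<Rightarrow> real) \<Rightarrow> bool" where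
  "GENEO X \<Phi> G F \<longleftrightarrow>
     F \<in> \<Phi> \<rightarrow> \<Phi> \<and>
     (\<forall>\<phi>\<in>\<Phi>. \<forall>g\<in>G. F (compose X \<phi> g) = compose X (F \<phi>) g) \<and>
     (\<forall>\<phi>1\<in>\<Phi>. \<forall>\<phi>2\<in>\<Phi>.
        sup_norm X (\<lambda>x. F \<phi>1 x - F \<phi>2 x) \<le> sup_norm X (\<lambda>x. \<phi>1 x - \<phi>2 x))"

text \<open>Sequences are indexed from 0. The sum is taken pointwise; it is the sum in
  \<open>C0b\<close> whenever the series converges uniformly.\<close>

definition series_op ::
  "'a set \<Rightarrow> (nat \<Rightarrow> real) \<Rightarrow> (nat \<Rightarrow> ('a \<Rightarrow> real) \<Rightarrow> 'a \<Rightarrow> real) \<Rightarrow> ('a \<Rightarrow> real) \<Rightarrow> 'a \<Rightarrow> real" where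
  "series_op X a F \<phi> = (\<lambda>x\<in>X. \<Sum>k. a k * F k \<phi> x)"

end

theory Submission
  imports Defs
begin

text \<open>Each term of a series is a difference of two consecutive partial sums, so the bound on
  the partial sums of \<open>F k \<phi>\<close> bounds every single \<open>F k \<phi>\<close> by one
  constant, uniformly in \<open>k\<close> and \<open>x\<close>
  (\<open>abs_le_twice_partial_sum_bound\<close>). The weighted series is then dominated by a
  multiple of the summable \<open>a\<close>; the Weierstrass M-test gives uniform convergence, and
  \<open>C0b_uniform_limit\<close> puts the sum into \<open>C0b\<close>. Equivariance passes to the
  sum pointwise. For non-expansivity, the difference of two values is at most the sum of
  \<open>a k * N\<close>, where \<open>N\<close> is the sup-distance of the arguments, and the total
  weight is at most 1.\<close>

lemma abs_le_twice_partial_sum_bound: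
  fixes f :: "nat \<Rightarrow> real"
  assumes "\<And>n. \<bar>\<Sum>k<n. f k\<bar> \<le> M"
  shows "\<bar>f k\<bar> \<le> 2 * M"
  using assms[of k] assms[of "Suc k"] by simp

text \<open>Boundedness is essential: the real \<open>SUP\<close> in \<open>sup_norm\<close> is
  known to be an upper bound only for families that are bounded above.\<close>

lemma abs_le_sup_norm:
  assumes "bounded (f ` X)" and "x \<in> X"
  shows "\<bar>f x\<bar> \<le> sup_norm X f"
  unfolding sup_norm_def
proof (rule cSUP_upper)
  show "bdd_above ((\<lambda>x. \<bar>f x\<bar>) ` X)"
    using assms(1) by (auto simp: bounded_iff bdd_above_def)
qed (fact assms(2))

lemma sup_norm_le:
  assumes "X \<noteq> {}" and "\<And>x. x \<in> X \<Longrightarrow> \<bar>f x\<bar> \<le> c"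
  shows "sup_norm X f \<le> c"
  unfolding sup_norm_def using assms by (rule cSUP_least)

lemma abs_diff_le_sup_norm:
  assumes "\<phi> \<in> C0b T" "\<psi> \<in> C0b T" "x \<in> topspace T"
  shows "\<bar>\<phi> x - \<psi> x\<bar> \<le> sup_norm (topspace T) (\<lambda>x. \<phi> x - \<psi> x)"
  using assms by (intro abs_le_sup_norm bounded_minus_comp) (simp_all add: C0b_iff)

text \<open>Continuity is the uniform limit theorem; for boundedness, a single \<open>f n\<close>
  within distance 1 of the limit suffices. Extensionality is a separate premise because convergence
  on \<open>topspace T\<close> says nothing about values outside it.\<close>

lemma C0b_uniform_limit:
  assumes lim: "uniform_limit (topspace T) f \<phi> sequentially"
    and f: "\<And>n. continuous_map T euclideanreal (f n)" "\<And>n. bounded (f n ` topspace T)"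
    and ext: "\<phi> \<in> extensional (topspace T)"
  shows "\<phi> \<in> C0b T"
proof -
  have "continuous_map T euclideanreal \<phi>"
  proof -
    have "continuous_map T (Met_TC.mtopology :: real topology) \<phi>"
    proof (rule Met_TC.continuous_map_uniform_limit)
      show "\<forall>\<^sub>F n in sequentially. continuous_map T Met_TC.mtopology (f n)"
        using f(1) by simp
      show "\<forall>\<^sub>F n in sequentially. \<forall>x\<in>topspace T. \<phi> x \<in> UNIV \<and> dist (f n x) (\<phi> x) < e"
        if "e > 0" for e
        using uniform_limitD[OF lim that] by simp
    qed simp
    then show ?thesis by simp
  qed
  moreover have "bounded (\<phi> ` topspace T)"
  proof -
    obtain n where n: "\<forall>x\<in>topspace T. dist (f n x) (\<phi> x) < 1"
      using uniform_limitD[OF lim zero_less_one] by (auto simp: eventually_sequentially)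
    obtain B where B: "\<And>x. x \<in> topspace T \<Longrightarrow> \<bar>f n x\<bar> \<le> B"
      using f(2)[of n] by (auto simp: bounded_iff)
    have "\<bar>\<phi> x\<bar> \<le> B + 1" if "x \<in> topspace T" for x
      using bspec[OF n that] B[OF that] by (simp add: dist_real_def)
    then show ?thesis by (auto simp: bounded_iff)
  qed
  ultimately show ?thesis using ext by (simp add: C0b_iff)
qed

text \<open>The first conjunct justifies the pointwise definition of \<open>series_op\<close>: its
  value is the uniform sum and lies in \<open>C0b\<close>, whether or not the operator maps \<Phi>
  into itself.\<close>

theorem proposition2:
  fixes X :: "'a set" and d :: "'a \<Rightarrow> 'a \<Rightarrow> real"
    and \<Phi> :: "('a \<Rightarrow> real) set" and G :: "('a \<Rightarrow> 'a) set"
    and a :: "nat \<Rightarrow> real" and F :: "nat \<Rightarrow> ('a \<Rightarrow> real) \<Rightarrow> 'a \<Rightarrow> real"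
  assumes "pseudometric_space X d" and "X \<noteq> {}"
    and "compact_space (pseudometric_topology X d)"
    and "\<Phi> \<subseteq> C0b (pseudometric_topology X d)"
    and "subgroup G (Homeo (pseudometric_topology X d))"
    and "\<And>\<phi> g. \<phi> \<in> \<Phi> \<Longrightarrow> g \<in> G \<Longrightarrow> compose X \<phi> g \<in> \<Phi>"
    and "\<And>k. 0 < a k" and "decseq a" and "summable a" and "(\<Sum>k. a k) \<le> 1"
    and "\<And>k. GENEO X \<Phi> G (F k)"
    and "\<And>\<phi>. \<phi> \<in> \<Phi> \<Longrightarrow> \<exists>M>0. \<forall>x\<in>X. \<forall>n. \<bar>\<Sum>k<n. F k \<phi> x\<bar> \<le> M"
  shows "(\<forall>\<phi>\<in>\<Phi>. series_op X a F \<phi> \<in> C0b (pseudometric_topology X d) \<and>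
            uniform_limit X (\<lambda>n x. \<Sum>k<n. a k * F k \<phi> x) (series_op X a F \<phi>) sequentially)
       \<and> (series_op X a F ` \<Phi> \<subseteq> \<Phi> \<longrightarrow> GENEO X \<Phi> G (series_op X a F))"
proof -
  let ?T = "pseudometric_topology X d" and ?S = "series_op X a F"
  \<comment> \<open>The domination for the M-test. The witness is twice the bound on the partial
    sums, and it depends on \<phi> only.\<close>
  have bound: "\<exists>M. \<forall>x\<in>X. \<forall>k. \<bar>a k * F k \<phi> x\<bar> \<le> a k * M" if "\<phi> \<in> \<Phi>" for \<phi>
  proof -
    obtain M where "\<forall>x\<in>X. \<forall>n. \<bar>\<Sum>k<n. F k \<phi> x\<bar> \<le> M"
      using assms(12) \<open>\<phi> \<in> \<Phi>\<close> by blast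
    then have "\<bar>F k \<phi> x\<bar> \<le> 2 * M" if "x \<in> X" for x k
      using that by (intro abs_le_twice_partial_sum_bound) simp
    then show ?thesis
      using assms(7) by (intro exI[of _ "2 * M"]) (simp add: abs_mult less_imp_le mult_left_mono)
  qed
  have summ: "summable (\<lambda>k. a k * F k \<phi> x)" if \<phi>: "\<phi> \<in> \<Phi>" and x: "x \<in> X" for \<phi> x
  proof -
    obtain M where "\<forall>x\<in>X. \<forall>k. \<bar>a k * F k \<phi> x\<bar> \<le> a k * M"
      using bound[OF \<phi>] by blast
    with x show ?thesis
      by (intro summable_comparison_test'[OF summable_mult2[OF assms(9), of M], of 0]) simp
  qed
  have F_C0b: "F k \<phi> \<in> C0b ?T" if "\<phi> \<in> \<Phi>" for k \<phi>
    using assms(4,11) that unfolding GENEO_def by blast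
  have lim: "uniform_limit X (\<lambda>n x. \<Sum>k<n. a k * F k \<phi> x) (?S \<phi>) sequentially" if "\<phi> \<in> \<Phi>" for \<phi>
  proof -
    obtain M where "\<forall>x\<in>X. \<forall>k. \<bar>a k * F k \<phi> x\<bar> \<le> a k * M"
      using bound[OF \<open>\<phi> \<in> \<Phi>\<close>] by blast
    then have "uniform_limit X (\<lambda>n x. \<Sum>k<n. a k * F k \<phi> x) (\<lambda>x. \<Sum>k. a k * F k \<phi> x) sequentially"
      using summable_mult2[OF assms(9), of M] by (intro Weierstrass_m_test) auto
    then show ?thesis
      \<comment> \<open>The M-test yields the unrestricted sum, which agrees with
        \<open>series_op\<close> on \<open>X\<close>.\<close>
      by (rule uniform_limit_cong'[THEN iffD1, rotated -1]) (simp_all add: series_op_def)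
  qed
  have C0b: "?S \<phi> \<in> C0b ?T" if "\<phi> \<in> \<Phi>" for \<phi>
  proof (rule C0b_uniform_limit)
    show "uniform_limit (topspace ?T) (\<lambda>n x. \<Sum>k<n. a k * F k \<phi> x) (?S \<phi>) sequentially"
      using lim[OF that] by simp
    show "continuous_map ?T euclideanreal (\<lambda>x. \<Sum>k<n. a k * F k \<phi> x)" for n
      using F_C0b[OF that]
      by (intro continuous_map_sum continuous_map_real_mult) (simp_all add: C0b_iff)
    show "bounded ((\<lambda>x. \<Sum>k<n. a k * F k \<phi> x) ` topspace ?T)" for n
    proof (induction n)
      case (Suc n)
      have "bounded (F n \<phi> ` topspace ?T)"
        using F_C0b[OF that, of n] by (simp only: C0b_iff)
      then have "bounded ((\<lambda>x. a n * F n \<phi> x) ` topspace ?T)"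
        using bounded_scaling[of "F n \<phi> ` topspace ?T" "a n"] by (simp add: image_image)
      with Suc show ?case by (simp add: bounded_plus_comp)
    qed (simp add: image_constant_conv)
    show "?S \<phi> \<in> extensional (topspace ?T)" by (simp add: series_op_def)
  qed
  have "GENEO X \<Phi> G ?S" if "?S ` \<Phi> \<subseteq> \<Phi>"
    unfolding GENEO_def
  proof (intro conjI ballI)
    show "?S \<in> \<Phi> \<rightarrow> \<Phi>" using that by blast
  next
    fix \<phi> g assume "\<phi> \<in> \<Phi>" "g \<in> G"
    then have eq: "F k (compose X \<phi> g) = compose X (F k \<phi>) g" for k
      using assms(11) unfolding GENEO_def by blast
    have "g \<in> Bij X"
      using subgroup.subset[OF assms(5)] \<open>g \<in> G\<close> by (auto simp: Homeo_def)
    \<comment> \<open>Keeps \<open>g x\<close> inside the domain of the restriction in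
      \<open>series_op\<close>, so both sides are the same series at \<open>g x\<close>.\<close>
    then have "g x \<in> X" if "x \<in> X" for x
      using that by (auto simp: Bij_def bij_betw_def)
    then show "?S (compose X \<phi> g) = compose X (?S \<phi>) g"
      unfolding series_op_def eq by (auto simp: compose_def intro: restrict_ext)
  next
    fix \<phi>1 \<phi>2 assume \<phi>: "\<phi>1 \<in> \<Phi>" "\<phi>2 \<in> \<Phi>"
    define N where "N = sup_norm X (\<lambda>x. \<phi>1 x - \<phi>2 x)"
    have le_N: "\<bar>F k \<phi>1 x - F k \<phi>2 x\<bar> \<le> N" if "x \<in> X" for k x
    proof -
      have "\<bar>F k \<phi>1 x - F k \<phi>2 x\<bar> \<le> sup_norm X (\<lambda>x. F k \<phi>1 x - F k \<phi>2 x)"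
        using abs_diff_le_sup_norm[OF F_C0b F_C0b] \<phi> that by simp
      also have "\<dots> \<le> N"
        using assms(11) \<phi> unfolding GENEO_def N_def by blast
      finally show ?thesis .
    qed
    \<comment> \<open>A point of \<open>X\<close> makes \<open>N\<close> dominate an absolute value;
      the sign is needed to multiply the bound on the total weight by \<open>N\<close>.\<close>
    then have "0 \<le> N" using assms(2) by (meson abs_ge_zero order_trans ex_in_conv)
    show "sup_norm X (\<lambda>x. ?S \<phi>1 x - ?S \<phi>2 x) \<le> sup_norm X (\<lambda>x. \<phi>1 x - \<phi>2 x)"
      unfolding N_def[symmetric]
    proof (rule sup_norm_le[OF assms(2)])
      fix x assume x: "x \<in> X"
      \<comment> \<open>Merging the two sums into one relies on the convergence of each, given by
        \<open>summ\<close>.\<close>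
      have "?S \<phi>1 x - ?S \<phi>2 x = (\<Sum>k. a k * (F k \<phi>1 x - F k \<phi>2 x))"
        using x \<phi> by (simp add: series_op_def suminf_diff[OF summ summ] right_diff_distrib)
      also have "\<bar>\<dots>\<bar> \<le> (\<Sum>k. a k * N)"
        using le_N[OF x] assms(7)
        by (intro norm_suminf_le[where 'a=real, unfolded real_norm_def] summable_mult2 assms(9))
          (simp add: abs_mult less_imp_le mult_left_mono)
      also have "\<dots> = (\<Sum>k. a k) * N" using suminf_mult2[OF assms(9)] by simp
      also have "\<dots> \<le> N" using mult_right_mono[OF assms(10) \<open>0 \<le> N\<close>] by simp
      finally show "\<bar>?S \<phi>1 x - ?S \<phi>2 x\<bar> \<le> N" .
    qed
  qed
  with lim C0b show ?thesis by blast
qed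

end
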